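(* Let $f \in \mathbb{R}[X,Y]$ with $f \ge 0$ on $[0,1]\times \mathbb{R}$ and $\deg_Y f \le 2$. Then there exist $\sigma_0, \sigma_1 \in \sum \mathbb{R}[X,Y]^2$ such that $$f = \sigma_0 + \sigma_1 X(1-X)$$ and $$\deg(\sigma_0) \le \deg_X f + 3, \qquad \deg(\sigma_1 X(1-X)) \le \deg_X f + 3.$$
   Context: $\sum \mathbb{R}[X,Y]^2$ denotes the set of finite sums of squares of polynomials in $\mathbb{R}[X,Y]$. $\deg$ denotes total degree, and $\deg_X$, $\deg_Y$ denote the degrees in the variables $X$ and $Y$ respectively. *)

theory Defs
  imports Complex_Main "HOL-Computational_Algebra.Polynomial"
begin

text \<open>
  A polynomial in two variables over \<open>R\<close> is an element of \<open>R[X][Y]\<close>, of type \<open>R poly poly\<close>: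
  the outer variable is \<open>Y\<close>, and \<open>coeff (coeff p j) i\<close> is the coefficient of \<open>X^i Y^j\<close>.
\<close>

definition varX :: "'a::comm_semiring_1 poly poly"
  where "varX = [:[:0, 1:]:]"

definition varY :: "'a::comm_semiring_1 poly poly"
  where "varY = [:0, 1:]"

definition eval2 :: "'a::comm_semiring_1 poly poly \<Rightarrow> 'a \<Rightarrow> 'a \<Rightarrow> 'a"
  where "eval2 p x y = poly (poly p [:y:]) x"

text \<open>As for \<^const>\<open>degree\<close>, each degree of the zero polynomial is \<open>0\<close>.\<close>

definition degX :: "'a::zero poly poly \<Rightarrow> nat"
  where "degX p = Max (insert 0 {i. \<exists>j. coeff (coeff p j) i \<noteq> 0})"

definition degY :: "'a::zero poly poly \<Rightarrow> nat"
  where "degY p = degree p"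

definition total_deg :: "'a::zero poly poly \<Rightarrow> nat"
  where "total_deg p = Max (insert 0 {i + j |i j. coeff (coeff p j) i \<noteq> 0})"

definition sums_of_squares :: "'a::comm_semiring_1 set"
  where "sums_of_squares = {(\<Sum>k<n. (q k)\<^sup>2) |(n::nat) q. True}"

lemma finite_monomials:
  "finite {(i, j). coeff (coeff p j) i \<noteq> 0}"
proof (rule finite_subset)
  show "{(i, j). coeff (coeff p j) i \<noteq> 0} \<subseteq> (\<Union>j\<le>degree p. {..degree (coeff p j)} \<times> {j})"
  proof clarsimp
    fix i j assume a: "coeff (coeff p j) i \<noteq> 0"
    then have "coeff p j \<noteq> 0" by auto
    with a show "j \<le> degree p \<and> i \<le> degree (coeff p j)" by (simp add: le_degree)
  qed
qed auto

lemma degX_le_iff: "degX p \<le> n \<longleftrightarrow> (\<forall>i j. coeff (coeff p j) i \<noteq> 0 \<longrightarrow> i \<le> n)"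
proof -
  have "{i. \<exists>j. coeff (coeff p j) i \<noteq> 0} = fst ` {(i, j). coeff (coeff p j) i \<noteq> 0}"
    by force
  then have "finite {i. \<exists>j. coeff (coeff p j) i \<noteq> 0}"
    by (simp add: finite_monomials)
  then show ?thesis by (auto simp: degX_def)
qed

lemma total_deg_le_iff:
  "total_deg p \<le> n \<longleftrightarrow> (\<forall>i j. coeff (coeff p j) i \<noteq> 0 \<longrightarrow> i + j \<le> n)"
proof -
  have "{i + j |i j. coeff (coeff p j) i \<noteq> 0}
      = (\<lambda>(i, j). i + j) ` {(i, j). coeff (coeff p j) i \<noteq> 0}"
    by force
  then have "finite {i + j |i j. coeff (coeff p j) i \<noteq> 0}"
    by (simp add: finite_monomials)
  then show ?thesis by (auto simp: total_deg_def)
qed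

lemma eval2_varX [simp]: "eval2 varX x y = x"
  and eval2_varY [simp]: "eval2 varY x y = y"
  by (simp_all add: eval2_def varX_def varY_def)

lemma eval2_sum_monomials:
  "eval2 p x y = (\<Sum>j\<le>degree p. poly (coeff p j) x * y ^ j)"
  by (simp add: eval2_def poly_altdef[of p] poly_sum)

end

theory Submission
  imports Defs "HOL-Computational_Algebra.Fundamental_Theorem_Algebra"
begin

text \<open>
  Write \<open>f = a + b Y + c Y\<^sup>2\<close> with \<open>a, b, c\<close> of degree at most \<open>2 m\<close>. The substitution
  \<open>X = t\<^sup>2 / (1 + t\<^sup>2)\<close>, multiplied by \<open>(1 + t\<^sup>2)^(2 m)\<close>, gives a quadratic in \<open>Y\<close> that is
  nonnegative for all real \<open>t\<close>, i.e. a positive semidefinite 2x2 matrix \<open>M\<close> over \<open>R[t]\<close>.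
  A nonzero multiple \<open>k\<^sup>* k M\<close> has a factorization \<open>P\<^sup>* P\<close> over \<open>C[t]\<close>, and the roots of \<open>k\<close> can be
  cancelled one at a time, so \<open>M = Q\<^sup>* Q\<close>. Real and imaginary parts of the rows of \<open>Q\<close> express the
  quadratic as a sum of four squares \<open>(p + q Y)\<^sup>2\<close>, whose degrees are controlled because squares
  cannot cancel. Averaging over \<open>t\<close> and \<open>-t\<close> replaces each square by \<open>E(t\<^sup>2)\<^sup>2 + t\<^sup>2 R(t\<^sup>2)\<^sup>2\<close>,
  where \<open>E\<close> and \<open>R\<close> come from the even and odd parts, and \<open>t\<^sup>2 = X / (1 - X)\<close> turns \<open>t\<^sup>2\<close> into
  \<open>X (1 - X)\<close> after clearing denominators.
\<close>

text \<open>The polynomial form of the adjoint: its value at \<open>z\<close> is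
  \<open>cnj (poly p (cnj z))\<close>, which on the real line is plain conjugation.\<close>

abbreviation cpoly :: "complex poly \<Rightarrow> complex poly"
  where "cpoly \<equiv> map_poly cnj"

lemma cpoly_mult: "cpoly (p * q) = cpoly p * cpoly q"
  by (simp flip: poly_eq_poly_eq_iff add: fun_eq_iff)

section \<open>Factoring polynomials that are nonnegative on the real line\<close>

lemma poly_eqI_infinite:
  fixes p q :: "'a::{idom,ring_char_0} poly"
  assumes "infinite S" and "\<And>x. x \<in> S \<Longrightarrow> poly p x = poly q x"
  shows "p = q"
proof (rule ccontr)
  assume "p \<noteq> q"
  then have "finite {x. poly (p - q) x = 0}" by (intro poly_roots_finite) simp
  moreover have "S \<subseteq> {x. poly (p - q) x = 0}" using assms(2) by auto
  ultimately show False using assms(1) finite_subset by blast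
qed

lemma infinite_complex_of_real: "infinite (range complex_of_real)"
  by (simp add: finite_image_iff inj_of_real infinite_UNIV_char_0)

lemma poly_nonneg_except_point:
  fixes p :: "real poly"
  assumes "\<And>x. x \<noteq> a \<Longrightarrow> 0 \<le> poly p x"
  shows "0 \<le> poly p a"
proof (rule tendsto_lowerbound)
  show "((\<lambda>x. poly p x) \<longlongrightarrow> poly p a) (at a)"
    using isCont_def poly_isCont by blast
  show "\<forall>\<^sub>F x in at a. 0 \<le> poly p x"
    using assms by (auto simp: eventually_at_filter)
qed simp

lemma Re_poly_of_real: "Re (poly p (of_real x)) = poly (map_poly Re p) x"
  and Im_poly_of_real: "Im (poly p (of_real x)) = poly (map_poly Im p) x"
  by (induction p) (simp_all add: map_poly_pCons)

text \<open>Roots are split off in pairs \<open>t\<close>, \<open>cnj t\<close>: the product of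
  their linear factors is nonnegative on the real line, so the cofactor satisfies the hypothesis
  again, with degree smaller by two.\<close>

lemma nonneg_real_valued_eq_cpoly_mult:
  fixes d :: "complex poly"
  assumes "\<And>x::real. poly d (of_real x) \<in> \<real> \<and> 0 \<le> Re (poly d (of_real x))"
  shows "\<exists>w. d = cpoly w * w"
  using assms
proof (induction "degree d" arbitrary: d rule: less_induct)
  case less
  have rv: "\<And>x::real. poly d (of_real x) \<in> \<real>" and nn: "\<And>x::real. 0 \<le> Re (poly d (of_real x))"
    using less.prems by auto
  show ?case
  proof (cases "degree d = 0")
    case True
    then obtain e where e: "d = [:e:]" by (metis degree_eq_zeroE)
    have "e \<in> \<real>" "0 \<le> Re e" using rv[of 0] nn[of 0] e by auto
    then have "d = cpoly [:of_real (sqrt (Re e)):] * [:of_real (sqrt (Re e)):]"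
      using e by (simp add: map_poly_pCons flip: of_real_mult)
    then show ?thesis by blast
  next
    case False
    have "\<not> constant (poly d)" using False by (simp add: constant_degree)
    then obtain t where t: "poly d t = 0" using fundamental_theorem_of_algebra by blast
    \<comment> \<open>Real values on the real line force real coefficients, so \<open>cnj t\<close>
      is a root as well.\<close>
    have selfconj: "cpoly d = d"
    proof (rule poly_eqI_infinite[OF infinite_complex_of_real])
      show "poly (cpoly d) z = poly d z" if "z \<in> range complex_of_real" for z
        using that rv by (auto simp: Reals_cnj_iff)
    qed
    obtain e where e: "d = [:-t, 1:] * e" using t poly_eq_0_iff_dvd by (metis dvdE)
    have "poly e (cnj t) = 0"
    proof (cases "cnj t = t")
      case False
      have "poly d (cnj t) = cnj (poly (cpoly d) t)" by simp
      then have "poly d (cnj t) = 0" using t selfconj by simp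
      then show ?thesis using False e by simp
    next
      case True
      then obtain r where r: "t = of_real r" by (metis Reals_cnj_iff Reals_cases)
      have im: "poly (map_poly Im e) x = 0" if "x \<noteq> r" for x
      proof -
        have "of_real (x - r) * poly e (of_real x) \<in> \<real>"
          using rv[of x] by (simp add: e r algebra_simps)
        then show ?thesis using that
          by (simp add: complex_is_Real_iff flip: Im_poly_of_real)
      qed
      \<comment> \<open>The real part of \<open>e\<close> is nonpositive to the left of
        \<open>r\<close> and nonnegative to the right, so it vanishes at \<open>r\<close> and the
        real root is at least double.\<close>
      have re: "0 \<le> (x - r) * poly (map_poly Re e) x" for x
      proof -
        have "0 \<le> Re (of_real (x - r) * poly e (of_real x))"
          using nn[of x] by (simp add: e r algebra_simps)
        then show ?thesis by (simp flip: Re_poly_of_real)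
      qed
      have "poly (map_poly Re e) r = 0"
      proof (rule antisym)
        have ev: "((\<lambda>x. poly (map_poly Re e) x) \<longlongrightarrow> poly (map_poly Re e) r) (at r)"
          using isCont_def poly_isCont by blast
        show "0 \<le> poly (map_poly Re e) r"
        proof (rule tendsto_lowerbound)
          show "((\<lambda>x. poly (map_poly Re e) x) \<longlongrightarrow> poly (map_poly Re e) r) (at_right r)"
            using ev filterlim_at_split by blast
          show "\<forall>\<^sub>F x in at_right r. 0 \<le> poly (map_poly Re e) x"
            using re by (auto simp: eventually_at_filter zero_le_mult_iff intro!: always_eventually)
              (smt (verit, best) re mult_pos_neg)
        qed simp
        show "poly (map_poly Re e) r \<le> 0"
        proof (rule tendsto_upperbound)
          show "((\<lambda>x. poly (map_poly Re e) x) \<longlongrightarrow> poly (map_poly Re e) r) (at_left r)"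
            using ev filterlim_at_split by blast
          show "\<forall>\<^sub>F x in at_left r. poly (map_poly Re e) x \<le> 0"
            using re by (auto simp: eventually_at_filter zero_le_mult_iff intro!: always_eventually)
              (smt (verit, best) re mult_neg_pos)
        qed simp
      qed
      moreover have "poly (map_poly Im e) r = 0"
      proof -
        have "map_poly Im e = 0"
          by (rule poly_eqI_infinite[of "UNIV - {r}"]) (use im in \<open>auto simp: infinite_UNIV_char_0\<close>)
        then show ?thesis by simp
      qed
      ultimately show ?thesis
        using True by (simp add: r complex_eq_iff Re_poly_of_real Im_poly_of_real)
    qed
    then obtain g where g: "e = [:-cnj t, 1:] * g" using poly_eq_0_iff_dvd by (metis dvdE)
    have dg: "d = cpoly [:-t, 1:] * [:-t, 1:] * g"
      by (simp flip: poly_eq_poly_eq_iff add: e g map_poly_pCons fun_eq_iff algebra_simps)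
    have val: "poly d (of_real x) = of_real ((cmod (of_real x - t))\<^sup>2) * poly g (of_real x)" for x :: real
      unfolding complex_norm_square by (simp add: dg map_poly_pCons algebra_simps)
    have "d \<noteq> 0" using False by auto
    then have "g \<noteq> 0" using dg by auto
    have "degree d = degree g + 2"
      using \<open>g \<noteq> 0\<close> unfolding dg by (subst degree_mult_eq; (simp add: map_poly_pCons)?)
    \<comment> \<open>The only real point where the factor can vanish is \<open>Re t\<close>; that
      point is recovered afterwards because \<open>g\<close> is a polynomial.\<close>
    have off: "poly (map_poly Im g) x = 0 \<and> 0 \<le> poly (map_poly Re g) x" if "x \<noteq> Re t" for x
    proof -
      have "0 < (cmod (of_real x - t))\<^sup>2" using that by (auto simp: complex_eq_iff)
      then show ?thesis using rv[of x] nn[of x] unfolding val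
        by (auto simp: complex_is_Real_iff zero_le_mult_iff not_less simp flip: Re_poly_of_real Im_poly_of_real)
    qed
    have "map_poly Im g = 0"
    proof (rule poly_eqI_infinite[of "UNIV - {Re t}"])
      show "poly (map_poly Im g) x = poly 0 x" if "x \<in> UNIV - {Re t}" for x
        using off[of x] that by auto
    qed (simp add: infinite_UNIV_char_0)
    moreover have "0 \<le> poly (map_poly Re g) x" for x
    proof (cases "x = Re t")
      case True
      show ?thesis unfolding True
        by (rule poly_nonneg_except_point) (use off in auto)
    next
      case False
      then show ?thesis using off[of x] by auto
    qed
    ultimately have "\<exists>w. g = cpoly w * w"
      using \<open>degree d = degree g + 2\<close>
      by (intro less.hyps) (auto simp: complex_is_Real_iff Re_poly_of_real Im_poly_of_real)
    then obtain w where w: "g = cpoly w * w" by blast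
    have "d = cpoly ([:-t, 1:] * w) * ([:-t, 1:] * w)"
      unfolding cpoly_mult dg w by (simp only: mult_ac)
    then show ?thesis by blast
  qed
qed

section \<open>Hermitian factorizations of 2x2 matrices\<close>

text \<open>The product of row \<open>(p1, p2)\<^sup>*\<close> and column \<open>(q1, q2)\<close>: with these pairs as the two columns
  of a matrix \<open>P\<close>, the values of \<open>herm\<close> are the entries of \<open>P\<^sup>* P\<close>.\<close>

definition herm :: "complex poly \<Rightarrow> complex poly \<Rightarrow> complex poly \<Rightarrow> complex poly \<Rightarrow> complex poly"
  where "herm p1 p2 q1 q2 = cpoly p1 * q1 + cpoly p2 * q2"

lemma poly_herm:
  "poly (herm p1 p2 q1 q2) z
    = cnj (poly p1 (cnj z)) * poly q1 z + cnj (poly p2 (cnj z)) * poly q2 z"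
  by (simp add: herm_def)

lemma herm_mult_left: "herm (l * p1) (m * p2) (l * q1) (m * q2)
    = cpoly l * l * (cpoly p1 * q1) + cpoly m * m * (cpoly p2 * q2)"
  by (simp add: herm_def cpoly_mult algebra_simps)

text \<open>Both columns are multiplied by the constant unitary matrix with rows
  \<open>(cnj u, cnj v) / r\<close> and \<open>(- v, u) / r\<close>.\<close>

lemma herm_rotate:
  assumes "cnj u * u + cnj v * v = of_real (r\<^sup>2)" and "r \<noteq> 0"
  shows "herm (smult (1 / of_real r) (smult (cnj u) p1 + smult (cnj v) p2))
              (smult (1 / of_real r) (smult u p2 - smult v p1))
              (smult (1 / of_real r) (smult (cnj u) q1 + smult (cnj v) q2))
              (smult (1 / of_real r) (smult u q2 - smult v q1))
         = herm p1 p2 q1 q2" (is "?L = ?R")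
proof -
  have "poly ?L z = poly ?R z" for z
  proof -
    let ?a = "cnj (poly p1 (cnj z))" and ?b = "cnj (poly p2 (cnj z))"
    let ?c = "poly q1 z" and ?d = "poly q2 z"
    have "of_real (r\<^sup>2) * poly ?L z = (u * ?a + v * ?b) * (cnj u * ?c + cnj v * ?d)
        + (cnj u * ?b - cnj v * ?a) * (u * ?d - v * ?c)"
      using assms(2) by (simp add: poly_herm field_simps power2_eq_square)
    also have "\<dots> = (cnj u * u + cnj v * v) * (?a * ?c + ?b * ?d)"
      by (simp add: algebra_simps)
    also have "\<dots> = of_real (r\<^sup>2) * poly ?R z"
      by (simp only: assms(1) poly_herm)
    finally show ?thesis using assms(2) by simp
  qed
  then show ?thesis by (simp flip: poly_eq_poly_eq_iff add: fun_eq_iff)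
qed

text \<open>At a root \<open>t\<close> of the linear factor, the columns of the factor matrix at \<open>t\<close> are orthogonal
  to those at \<open>cnj t\<close>. Hence either all columns vanish at one of these points, or a constant unitary
  rotation makes the first row vanish at \<open>cnj t\<close> and the second one at \<open>t\<close>.\<close>

lemma herm_cancel_linear:
  fixes a b c :: "complex poly" and t :: complex
  defines "l \<equiv> [:-t, 1:]"
  assumes a: "cpoly l * l * a = herm p1 p2 p1 p2"
    and b: "cpoly l * l * b = herm p1 p2 q1 q2"
    and c: "cpoly l * l * c = herm q1 q2 q1 q2"
  shows "\<exists>p1 p2 q1 q2. a = herm p1 p2 p1 p2 \<and> b = herm p1 p2 q1 q2 \<and> c = herm q1 q2 q1 q2"
proof -
  define s where "s = cnj t"
  define l' where "l' = [:-s, 1:]"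
  have l': "cpoly l = l'" "cpoly l' = l" by (simp_all add: l_def l'_def s_def map_poly_pCons)
  have nz: "cpoly l * l \<noteq> 0" unfolding l' by (simp add: l_def l'_def)
  \<comment> \<open>Since \<open>cpoly m * m\<close> is the same for \<open>m = l\<close> and
    \<open>m = l'\<close>, each row may be divided by either factor, independently of the other
    row.\<close>
  have cancel: ?thesis
    if "herm p1 p2 p1 p2 = herm (m * P1) (m' * P2) (m * P1) (m' * P2)"
       "herm p1 p2 q1 q2 = herm (m * P1) (m' * P2) (m * Q1) (m' * Q2)"
       "herm q1 q2 q1 q2 = herm (m * Q1) (m' * Q2) (m * Q1) (m' * Q2)"
       "m \<in> {l, l'}" "m' \<in> {l, l'}" for m m' P1 P2 Q1 Q2
  proof -
    have "cpoly m * m = cpoly l * l" "cpoly m' * m' = cpoly l * l"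
      using that(4,5) l' by (auto simp: mult.commute)
    then have "herm (m * F1) (m' * F2) (m * G1) (m' * G2) = cpoly l * l * herm F1 F2 G1 G2" for F1 F2 G1 G2
      by (simp add: herm_mult_left) (simp add: herm_def algebra_simps)
    then show ?thesis using that(1-3) nz unfolding a[symmetric] b[symmetric] c[symmetric]
      by (metis mult_left_cancel)
  qed
  have zero: "poly (cpoly l * l * x) t = 0" "poly (cpoly l * l * x) s = 0" for x
    unfolding l' poly_mult by (simp_all add: l_def l'_def)
  have at_t: "poly (herm p1 p2 p1 p2) t = 0" "poly (herm p1 p2 q1 q2) t = 0" "poly (herm q1 q2 q1 q2) t = 0"
   and at_s: "poly (herm p1 p2 q1 q2) s = 0"
    unfolding a[symmetric] b[symmetric] c[symmetric] by (rule zero)+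
  define u1 u2 v1 v2 where "u1 = poly p1 t" and "u2 = poly p2 t" and "v1 = poly q1 t" and "v2 = poly q2 t"
  define x1 x2 y1 y2 where "x1 = poly p1 s" and "x2 = poly p2 s" and "y1 = poly q1 s" and "y2 = poly q2 s"
  note defs = u1_def u2_def v1_def v2_def x1_def x2_def y1_def y2_def
  have xu: "cnj x1 * u1 + cnj x2 * u2 = 0" and xv: "cnj x1 * v1 + cnj x2 * v2 = 0"
    and yv: "cnj y1 * v1 + cnj y2 * v2 = 0"
    using at_t by (simp_all add: poly_herm defs s_def)
  \<comment> \<open>The remaining relation comes from the off-diagonal entry at \<open>s\<close>,
    conjugated.\<close>
  have "cnj u1 * y1 + cnj u2 * y2 = 0"
    using at_s by (simp add: poly_herm defs s_def)
  from arg_cong[OF this, of cnj] have yu: "cnj y1 * u1 + cnj y2 * u2 = 0"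
    by (simp add: mult.commute)
  consider "u1 = 0" "u2 = 0" "v1 = 0" "v2 = 0" | "x1 = 0" "x2 = 0" "y1 = 0" "y2 = 0"
    | w1 w2 z1 z2 where "(w1, w2) \<in> {(u1, u2), (v1, v2)}" "(w1, w2) \<noteq> (0, 0)"
        "(z1, z2) \<in> {(x1, x2), (y1, y2)}" "(z1, z2) \<noteq> (0, 0)"
  proof -
    have "\<exists>w1 w2. (w1, w2) \<in> {(u1, u2), (v1, v2)} \<and> (w1, w2) \<noteq> (0, 0)"
      if "\<not> (u1 = 0 \<and> u2 = 0 \<and> v1 = 0 \<and> v2 = 0)" using that by auto
    moreover have "\<exists>z1 z2. (z1, z2) \<in> {(x1, x2), (y1, y2)} \<and> (z1, z2) \<noteq> (0, 0)"
      if "\<not> (x1 = 0 \<and> x2 = 0 \<and> y1 = 0 \<and> y2 = 0)" using that by auto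
    ultimately show thesis using that by blast
  qed
  then show ?thesis
  proof cases
    case 1
    then have "l dvd p1" "l dvd p2" "l dvd q1" "l dvd q2"
      by (simp_all add: defs l_def poly_eq_0_iff_dvd)
    then obtain P1 P2 Q1 Q2 where "p1 = l * P1" "p2 = l * P2" "q1 = l * Q1" "q2 = l * Q2"
      by (elim dvdE) (rule that)
    then show ?thesis using cancel[of l P1 l P2 Q1 Q2] by simp
  next
    case 2
    then have "l' dvd p1" "l' dvd p2" "l' dvd q1" "l' dvd q2"
      by (simp_all add: defs l'_def poly_eq_0_iff_dvd)
    then obtain P1 P2 Q1 Q2 where "p1 = l' * P1" "p2 = l' * P2" "q1 = l' * Q1" "q2 = l' * Q2"
      by (elim dvdE) (rule that)
    then show ?thesis using cancel[of l' P1 l' P2 Q1 Q2] by simp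
  next
    case 3
    define r where "r = sqrt ((cmod w1)\<^sup>2 + (cmod w2)\<^sup>2)"
    have "(cmod w1)\<^sup>2 + (cmod w2)\<^sup>2 \<noteq> 0" using 3(2) by (auto simp: sum_power2_eq_zero_iff)
    then have r0: "r \<noteq> 0" by (simp add: r_def)
    have r: "cnj w1 * w1 + cnj w2 * w2 = of_real (r\<^sup>2)"
      by (simp add: r_def mult.commute[of "cnj _"] flip: complex_norm_square)
    have zu: "cnj z1 * u1 + cnj z2 * u2 = 0" and zv: "cnj z1 * v1 + cnj z2 * v2 = 0"
      using 3(3) xu xv yu yv by auto
    \<comment> \<open>As \<open>z\<close> is nonzero, the solutions \<open>h\<close> form a line. It
      also contains \<open>w\<close>, so the determinant of \<open>w\<close> and \<open>h\<close>
      vanishes.\<close>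
    have par: "w1 * h2 - w2 * h1 = 0" if "cnj z1 * h1 + cnj z2 * h2 = 0" for h1 h2
    proof -
      have "cnj z1 * w1 + cnj z2 * w2 = 0" using 3(1) zu zv by auto
      with that have "cnj z1 * (w1 * h2 - w2 * h1) = 0" "cnj z2 * (w1 * h2 - w2 * h1) = 0"
        by algebra+
      then show ?thesis using 3(4) by auto
    qed
    have orth: "cnj w1 * x1 + cnj w2 * x2 = 0" "cnj w1 * y1 + cnj w2 * y2 = 0"
    proof -
      have "cnj (cnj w1 * x1 + cnj w2 * x2) = 0" "cnj (cnj w1 * y1 + cnj w2 * y2) = 0"
        using 3(1) xu xv yu yv by (auto simp: mult.commute)
      then show "cnj w1 * x1 + cnj w2 * x2 = 0" "cnj w1 * y1 + cnj w2 * y2 = 0"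
        by (simp_all only: complex_cnj_zero_iff)
    qed
    let ?F = "\<lambda>p1 p2. smult (1 / of_real r) (smult (cnj w1) p1 + smult (cnj w2) p2)"
    let ?G = "\<lambda>p1 p2. smult (1 / of_real r) (smult w1 p2 - smult w2 p1)"
    have "poly (?F p1 p2) s = 0" "poly (?G p1 p2) t = 0" "poly (?F q1 q2) s = 0" "poly (?G q1 q2) t = 0"
      using orth par[OF zu] par[OF zv] by (simp_all add: defs)
    then have "l' dvd ?F p1 p2" "l dvd ?G p1 p2" "l' dvd ?F q1 q2" "l dvd ?G q1 q2"
      unfolding l_def l'_def poly_eq_0_iff_dvd[symmetric] by -
    then obtain P1 P2 Q1 Q2 where FG:
      "?F p1 p2 = l' * P1" "?G p1 p2 = l * P2" "?F q1 q2 = l' * Q1" "?G q1 q2 = l * Q2"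
      by (elim dvdE) (rule that)
    have rot: "herm (?F a1 a2) (?G a1 a2) (?F b1 b2) (?G b1 b2) = herm a1 a2 b1 b2" for a1 a2 b1 b2
      by (rule herm_rotate[OF r r0])
    show ?thesis
      using rot[of p1 p2 p1 p2] rot[of p1 p2 q1 q2] rot[of q1 q2 q1 q2] unfolding FG
      by (intro cancel[of l' P1 l P2 Q1 Q2]) simp_all
  qed
qed

text \<open>Induction on the degree of \<open>k\<close>: each root cancels a linear factor, and a
  final constant \<open>e\<close> is absorbed by dividing the factor matrix by
  \<open>e\<close>.\<close>

lemma herm_cancel:
  fixes a b c k :: "complex poly"
  assumes "k \<noteq> 0" and "cpoly k * k * a = herm p1 p2 p1 p2"
    and "cpoly k * k * b = herm p1 p2 q1 q2" and "cpoly k * k * c = herm q1 q2 q1 q2"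
  shows "\<exists>p1 p2 q1 q2. a = herm p1 p2 p1 p2 \<and> b = herm p1 p2 q1 q2 \<and> c = herm q1 q2 q1 q2"
  using assms
proof (induction "degree k" arbitrary: k p1 p2 q1 q2)
  case 0
  then obtain e where e: "k = [:e:]" "e \<noteq> 0" by (metis degree_eq_zeroE pCons_eq_0_iff)
  have "cpoly k * k * x = smult (cnj e * e) x" for x by (simp add: e map_poly_pCons mult.commute)
  then have eq: "cpoly k * k * x = y \<Longrightarrow> x = smult (1 / (cnj e * e)) y" for x y using e(2) by auto
  have sm: "smult (1 / (cnj e * e)) (herm f1 f2 g1 g2)
      = herm (smult (1 / e) f1) (smult (1 / e) f2) (smult (1 / e) g1) (smult (1 / e) g2)" for f1 f2 g1 g2
    by (simp flip: poly_eq_poly_eq_iff add: fun_eq_iff poly_herm) (simp add: add_divide_distrib mult_ac)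
  show ?case using 0(3-5)[THEN eq] unfolding sm by blast
next
  case (Suc n)
  have "\<not> constant (poly k)" using Suc.hyps(2) by (simp add: constant_degree)
  then obtain t where "poly k t = 0" using fundamental_theorem_of_algebra by blast
  then obtain g where g: "k = [:-t, 1:] * g" by (metis poly_eq_0_iff_dvd dvdE)
  then have "g \<noteq> 0" using Suc.prems(1) by auto
  have "degree k = Suc (degree g)" using \<open>g \<noteq> 0\<close> unfolding g by (subst degree_mult_eq) auto
  have kg: "cpoly k * k * x = cpoly [:-t, 1:] * [:-t, 1:] * (cpoly g * g * x)" for x
    unfolding g cpoly_mult by (simp only: mult_ac)
  have "\<exists>p1 p2 q1 q2. cpoly g * g * a = herm p1 p2 p1 p2 \<and> cpoly g * g * b = herm p1 p2 q1 q2
      \<and> cpoly g * g * c = herm q1 q2 q1 q2"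
    using Suc.prems(2-4) unfolding kg by (rule herm_cancel_linear)
  then show ?case
    using Suc.hyps(1)[of g] Suc.hyps(2) \<open>degree k = Suc (degree g)\<close> \<open>g \<noteq> 0\<close> by auto
qed

section \<open>From a nonnegative quadratic to four squares\<close>

lemma nonneg_quadratic:
  fixes a b c :: real
  assumes nn: "\<And>y. 0 \<le> a + b * y + c * y\<^sup>2"
  shows "0 \<le> c" and "b\<^sup>2 \<le> 4 * (a * c)"
proof -
  have a: "0 \<le> a" using nn[of 0] by simp
  show c: "0 \<le> c"
  proof (rule ccontr)
    assume "\<not> 0 \<le> c"
    \<comment> \<open>Chosen so that \<open>a + c * y\<^sup>2 = -1\<close>: the values at
      \<open>y\<close> and \<open>- y\<close> then add up to -2.\<close>
    define y where "y = sqrt ((a + 1) / - c)"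
    have "y\<^sup>2 = (a + 1) / - c" using a \<open>\<not> 0 \<le> c\<close> by (simp add: y_def divide_nonneg_neg)
    then have "c * y\<^sup>2 = - (a + 1)" using \<open>\<not> 0 \<le> c\<close> by (simp add: field_simps)
    with nn[of y] nn[of "- y"] show False by simp
  qed
  show "b\<^sup>2 \<le> 4 * (a * c)"
  proof (cases "c = 0")
    case True
    have "b = 0"
    proof (rule ccontr)
      assume "b \<noteq> 0"
      then show False using nn[of "- (a + 1) / b"] True by simp
    qed
    then show ?thesis using True by simp
  next
    case False
    have "a + b * (- b / (2 * c)) + c * (- b / (2 * c))\<^sup>2 = (4 * (a * c) - b\<^sup>2) / (4 * c)"
      using False by (simp add: field_simps power2_eq_square)
    then show ?thesis using nn[of "- b / (2 * c)"] False c by (simp add: zero_le_divide_iff)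
  qed
qed

lemma poly_map_of_real: "poly (map_poly of_real p) (of_real x) = (of_real (poly p x) :: complex)"
  by (induction p) (simp_all add: map_poly_pCons)

lemma nonneg_poly_eq_cpoly_mult:
  assumes "\<And>x::real. 0 \<le> poly d x"
  obtains w where "map_poly of_real d = cpoly w * w"
  using nonneg_real_valued_eq_cpoly_mult[of "map_poly of_real d"] assms
  by (auto simp: poly_map_of_real)

lemma cpoly_map_of_real: "cpoly (map_poly of_real p) = map_poly of_real p"
  by (simp add: map_poly_map_poly o_def)

text \<open>The matrix \<open>M\<close> with rows \<open>(a, b/2)\<close> and \<open>(b/2, c)\<close> satisfies \<open>c M = P\<^sup>* P\<close> for
  the matrix \<open>P\<close> with rows \<open>(b/2, c)\<close> and \<open>(w, 0)\<close>, where \<open>w\<^sup>* w = det M\<close>.\<close>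

lemma psd_hermitian_factorization:
  fixes a b c :: "real poly"
  assumes nn: "\<And>x y. 0 \<le> poly a x + poly b x * y + poly c x * y\<^sup>2"
  shows "\<exists>p1 p2 q1 q2. map_poly of_real a = herm p1 p2 p1 p2 \<and>
           map_poly of_real b = smult 2 (herm p1 p2 q1 q2) \<and> map_poly of_real c = herm q1 q2 q1 q2"
proof -
  define b' where "b' = smult (1/2) b"
  have b: "map_poly complex_of_real b = smult 2 (map_poly of_real b')"
    unfolding b'_def
    by (rule poly_eqI_infinite[OF infinite_complex_of_real]) (auto simp: poly_map_of_real)
  define d where "d = a * c - b' * b'"
  have "0 \<le> poly d x" for x
    using nonneg_quadratic(2)[OF nn, of x] by (simp add: d_def b'_def power2_eq_square)
  then obtain w where w: "map_poly of_real d = cpoly w * w" by (rule nonneg_poly_eq_cpoly_mult)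
  show ?thesis
  proof (cases "c = 0")
    case True
    \<comment> \<open>The multiplier \<open>c = 0\<close> cannot be cancelled, but the discriminant
      bound then forces \<open>b = 0\<close>, leaving the scalar factorization of
      \<open>a\<close>.\<close>
    have "poly b x = poly 0 x" for x using nonneg_quadratic(2)[OF nn, of x] True by simp
    then have "b = 0" by (simp flip: poly_eq_poly_eq_iff add: fun_eq_iff)
    have "0 \<le> poly a x" for x using nn[of x 0] by simp
    then obtain v where v: "map_poly of_real a = cpoly v * v" by (rule nonneg_poly_eq_cpoly_mult)
    show ?thesis
      by (rule exI[of _ v], rule exI[of _ 0], rule exI[of _ 0], rule exI[of _ 0])
        (simp add: v True \<open>b = 0\<close> herm_def)
  next
    case False
    have "0 \<le> poly c x" for x by (rule nonneg_quadratic(1)[OF nn])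
    then obtain k where k: "map_poly of_real c = cpoly k * k" by (rule nonneg_poly_eq_cpoly_mult)
    have "map_poly of_real c \<noteq> (0 :: complex poly)" using False by (simp add: map_poly_eq_0_iff)
    then have "k \<noteq> 0" using k by auto
    have ac: "map_poly of_real c * map_poly of_real a
        = map_poly of_real b' * map_poly of_real b' + cpoly w * w"
      unfolding w[symmetric] d_def
      by (rule poly_eqI_infinite[OF infinite_complex_of_real]) (auto simp: poly_map_of_real algebra_simps)
    have "\<exists>p1 p2 q1 q2. map_poly of_real a = herm p1 p2 p1 p2 \<and>
        map_poly of_real b' = herm p1 p2 q1 q2 \<and> map_poly of_real c = herm q1 q2 q1 q2"
      using \<open>k \<noteq> 0\<close>
    proof (rule herm_cancel[of k _ "map_poly of_real b'" w _ "map_poly of_real c" 0])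
    qed (simp_all add: k[symmetric] ac herm_def cpoly_map_of_real)
    then show ?thesis unfolding b by metis
  qed
qed

text \<open>On the real line \<open>cnj z * z\<close> is the sum of the squares of the real and
  imaginary parts, so each of the two rows yields two squares. The separate formulas for
  \<open>a\<close> and \<open>c\<close> serve to bound the degrees of \<open>p k\<close> and
  \<open>q k\<close>.\<close>

lemma psd_quadratic_sum_of_squares:
  fixes a b c :: "real poly"
  assumes "\<And>x y. 0 \<le> poly a x + poly b x * y + poly c x * y\<^sup>2"
  obtains p q :: "nat \<Rightarrow> real poly" where
    "\<And>x y. poly a x + poly b x * y + poly c x * y\<^sup>2 = (\<Sum>k<4. (poly (p k) x + poly (q k) x * y)\<^sup>2)"
    "\<And>x. poly a x = (\<Sum>k<4. (poly (p k) x)\<^sup>2)"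
    "\<And>x. poly c x = (\<Sum>k<4. (poly (q k) x)\<^sup>2)"
proof -
  obtain p1 p2 q1 q2 where a: "map_poly of_real a = herm p1 p2 p1 p2"
      and b: "map_poly of_real b = smult 2 (herm p1 p2 q1 q2)"
      and c: "map_poly of_real c = herm q1 q2 q1 q2"
    using psd_hermitian_factorization[OF assms] by blast
  define p where "p = (!) [map_poly Re p1, map_poly Im p1, map_poly Re p2, map_poly Im p2]"
  define q where "q = (!) [map_poly Re q1, map_poly Im q1, map_poly Re q2, map_poly Im q2]"
  have re: "poly g x = Re (poly (map_poly of_real g) (of_real x))" for g x
    by (simp add: poly_map_of_real)
  note expand = lessThan_nat_numeral lessThan_Suc numeral_eq_Suc p_def q_def
  have A: "poly a x = (\<Sum>k<4. (poly (p k) x)\<^sup>2)" for x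
    unfolding re[of a] a
    by (simp add: poly_herm expand flip: Re_poly_of_real Im_poly_of_real)
  have C: "poly c x = (\<Sum>k<4. (poly (q k) x)\<^sup>2)" for x
    unfolding re[of c] c
    by (simp add: poly_herm expand flip: Re_poly_of_real Im_poly_of_real)
  have B: "poly b x = (\<Sum>k<4. 2 * (poly (p k) x * poly (q k) x))" for x
    unfolding re[of b] b
    by (simp add: poly_herm expand flip: Re_poly_of_real Im_poly_of_real)
  show thesis
  proof
    show "poly a x + poly b x * y + poly c x * y\<^sup>2 = (\<Sum>k<4. (poly (p k) x + poly (q k) x * y)\<^sup>2)" for x y
      unfolding A B C sum_distrib_right sum.distrib[symmetric]
      by (intro sum.cong refl) (simp add: power2_eq_square algebra_simps)
  qed (fact A C)+
qed

section \<open>Degrees of squared summands; even and odd parts\<close>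

lemma degree_le_of_square_le:
  fixes p g :: "real poly"
  assumes "\<And>x. (poly p x)\<^sup>2 \<le> poly g x"
  shows "2 * degree p \<le> degree g"
proof (rule ccontr)
  assume *: "\<not> 2 * degree p \<le> degree g"
  then have "p \<noteq> 0" by auto
  have deg: "degree (p\<^sup>2) = 2 * degree p" using \<open>p \<noteq> 0\<close> by (simp add: degree_power_eq)
  \<comment> \<open>If the bound failed, \<open>p\<^sup>2\<close> would dominate \<open>g\<close> at
    infinity.\<close>
  have "coeff (p\<^sup>2 - g) (2 * degree p) = lead_coeff (p\<^sup>2)"
    using * deg by (simp add: coeff_eq_0)
  moreover have "degree (p\<^sup>2 - g) = 2 * degree p"
    using * deg by (metis degree_add_eq_left degree_minus diff_conv_add_uminus not_le)
  ultimately have "0 < lead_coeff (p\<^sup>2 - g)"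
    using \<open>p \<noteq> 0\<close> by (simp add: lead_coeff_power)
  then obtain n where "\<forall>x\<ge>n. lead_coeff (p\<^sup>2 - g) \<le> poly (p\<^sup>2 - g) x"
    using poly_pinfty_gt_lc by blast
  then have "0 < poly (p\<^sup>2 - g) n" using \<open>0 < lead_coeff (p\<^sup>2 - g)\<close> by fastforce
  then show False using assms[of n] by simp
qed

text \<open>Prepending a coefficient swaps the parts: \<open>pCons a p\<close> has even part
  \<open>pCons a r\<close> and odd part \<open>e\<close>. The case \<open>r = 0\<close> is separate
  because its degree is 0 by convention, which would violate the bound for constant
  \<open>p\<close>.\<close>

lemma even_odd_parts:
  fixes p :: "'a::comm_ring_1 poly"
  shows "\<exists>e r. (\<forall>x. poly p x = poly e (x\<^sup>2) + x * poly r (x\<^sup>2)) \<and>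
      2 * degree e \<le> degree p \<and> (r = 0 \<or> 2 * degree r + 1 \<le> degree p)"
proof (induction p)
  case 0
  show ?case by (rule exI[of _ 0], rule exI[of _ 0]) simp
next
  case (pCons a p)
  show ?case
  proof (cases "p = 0")
    case True
    show ?thesis by (rule exI[of _ "[:a:]"], rule exI[of _ 0]) (simp add: True)
  next
    case False
    from pCons obtain e r where er: "\<And>x. poly p x = poly e (x\<^sup>2) + x * poly r (x\<^sup>2)"
      "2 * degree e \<le> degree p" "r = 0 \<or> 2 * degree r + 1 \<le> degree p" by blast
    have "poly (pCons a p) x = poly (pCons a r) (x\<^sup>2) + x * poly e (x\<^sup>2)" for x
      by (simp add: er(1) power2_eq_square algebra_simps)
    moreover have "2 * degree (pCons a r) \<le> degree (pCons a p)"
      using er(3) False by (cases "r = 0") auto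
    moreover have "2 * degree e + 1 \<le> degree (pCons a p)" using er(2) False by simp
    ultimately show ?thesis by blast
  qed
qed

section \<open>Clearing denominators; total degree and evaluation in two variables\<close>

text \<open>\<open>v^n p(u/v)\<close> with denominators cleared; meaningful only for \<open>degree p \<le> n\<close>.\<close>

definition homog :: "nat \<Rightarrow> 'a::comm_ring_1 poly \<Rightarrow> 'a poly \<Rightarrow> 'a poly \<Rightarrow> 'a poly"
  where "homog n p u v = (\<Sum>i\<le>n. smult (coeff p i) (u ^ i * v ^ (n - i)))"

lemma homog_0 [simp]: "homog n 0 u v = 0"
  by (simp add: homog_def)

lemma poly_homog:
  fixes p :: "'a::field poly"
  assumes "degree p \<le> n" and "poly v x \<noteq> 0"
  shows "poly (homog n p u v) x = poly v x ^ n * poly p (poly u x / poly v x)"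
proof -
  have "poly p z = (\<Sum>i\<le>n. coeff p i * z ^ i)" for z
    unfolding poly_altdef using assms(1)
    by (intro sum.mono_neutral_left) (auto simp: coeff_eq_0)
  then show ?thesis using assms(2)
    by (simp add: homog_def poly_sum sum_distrib_left power_diff power_divide)
      (intro sum.cong, auto simp: field_simps)
qed

lemma degree_homog_le:
  assumes "degree u \<le> d" and "degree v \<le> d"
  shows "degree (homog n p u v) \<le> d * n"
  unfolding homog_def
proof (intro degree_sum_le)
  fix i assume "i \<in> {..n}"
  have "degree (smult (coeff p i) (u ^ i * v ^ (n - i))) \<le> degree u * i + degree v * (n - i)"
    by (meson add_mono degree_mult_le degree_power_le degree_smult_le order_trans)
  also have "\<dots> \<le> d * i + d * (n - i)" using assms by (intro add_mono mult_right_mono) auto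
  also have "\<dots> = d * n" using \<open>i \<in> {..n}\<close> by (simp flip: distrib_left)
  finally show "degree (smult (coeff p i) (u ^ i * v ^ (n - i))) \<le> d * n" .
qed simp

lemma total_deg_add_le:
  "total_deg p \<le> n \<Longrightarrow> total_deg q \<le> n \<Longrightarrow> total_deg (p + q) \<le> n"
  for p q :: "'a::comm_monoid_add poly poly"
  unfolding total_deg_le_iff by (metis add.right_neutral coeff_add)

lemma total_deg_sum_le:
  fixes g :: "'b \<Rightarrow> 'a::comm_monoid_add poly poly"
  assumes "\<And>k. k \<in> S \<Longrightarrow> total_deg (g k) \<le> n"
  shows "total_deg (sum g S) \<le> n"
  using assms
proof (induction S rule: infinite_finite_induct)
  case (insert x S)
  then show ?case by (simp add: total_deg_add_le)
qed (simp_all add: total_deg_le_iff)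

lemma total_deg_mult_le:
  fixes p q :: "'a::comm_semiring_1 poly poly"
  assumes p: "total_deg p \<le> m" and q: "total_deg q \<le> n"
  shows "total_deg (p * q) \<le> m + n"
  unfolding total_deg_le_iff
proof (intro allI impI)
  fix i j
  assume "coeff (coeff (p * q) j) i \<noteq> 0"
  then have "(\<Sum>l\<le>j. coeff (coeff p l * coeff q (j - l)) i) \<noteq> 0"
    by (simp add: coeff_mult coeff_sum)
  then obtain l where l: "l \<le> j" "coeff (coeff p l * coeff q (j - l)) i \<noteq> 0"
    by (metis (no_types, lifting) atMost_iff sum.neutral)
  then obtain h where h: "h \<le> i" "coeff (coeff p l) h * coeff (coeff q (j - l)) (i - h) \<noteq> 0"
    unfolding coeff_mult by (metis (no_types, lifting) atMost_iff sum.neutral)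
  have "coeff (coeff p l) h \<noteq> 0" and "coeff (coeff q (j - l)) (i - h) \<noteq> 0" using h by auto
  then have "h + l \<le> m" "i - h + (j - l) \<le> n"
    using p q unfolding total_deg_le_iff by blast+
  then show "i + j \<le> m + n" using l(1) h(1) by linarith
qed

lemma total_deg_linear_le:
  assumes "degree p \<le> n" and "degree q \<le> n"
  shows "total_deg [:p, q:] \<le> n + 1"
  unfolding total_deg_le_iff
proof (intro allI impI)
  fix i j
  assume "coeff (coeff [:p, q:] j) i \<noteq> 0"
  then have "j = 0 \<and> coeff p i \<noteq> 0 \<or> j = 1 \<and> coeff q i \<noteq> 0"
    by (auto simp: coeff_pCons split: nat.splits)
  then show "i + j \<le> n + 1" using assms le_degree[of p i] le_degree[of q i] by auto
qed

lemma eval2_add: "eval2 (p + q) x y = eval2 p x y + eval2 q x y"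
  and eval2_mult: "eval2 (p * q) x y = eval2 p x y * eval2 q x y"
  by (simp_all add: eval2_def)

lemma eval2_power: "eval2 (p ^ n) x y = eval2 p x y ^ n"
  by (simp add: eval2_def)

lemma eval2_sum: "eval2 (sum g S) x y = (\<Sum>k\<in>S. eval2 (g k) x y)"
  by (simp add: eval2_def poly_sum)

lemma eval2_linear: "eval2 [:p, q:] x y = poly p x + poly q x * y"
  by (simp add: eval2_def mult.commute)

text \<open>The univariate identity principle is applied twice: in \<open>X\<close> for each fixed
  \<open>y\<close>, then in the outer variable at the infinitely many constants
  \<open>[:y:]\<close>.\<close>

lemma eval2_eqI:
  fixes p q :: "'a::{idom,ring_char_0} poly poly"
  assumes "infinite S" and eq: "\<And>x y. x \<in> S \<Longrightarrow> eval2 p x y = eval2 q x y"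
  shows "p = q"
proof -
  have "infinite (range (\<lambda>y::'a. [:y:]))"
    by (simp add: finite_image_iff inj_def infinite_UNIV_char_0)
  then show ?thesis
  proof (rule poly_eqI_infinite)
    fix h assume "h \<in> range (\<lambda>y::'a. [:y:])"
    then obtain y where "h = [:y:]" by blast
    then show "poly p h = poly q h"
      using eq by (intro poly_eqI_infinite[OF assms(1)]) (simp add: eval2_def)
  qed
qed

section \<open>The certificate and its degrees\<close>

theorem theorem2:
  fixes f :: "real poly poly"
  assumes nonneg: "\<And>x y. 0 \<le> x \<Longrightarrow> x \<le> 1 \<Longrightarrow> eval2 f x y \<ge> 0"
    and degY: "degY f \<le> 2"
  shows "\<exists>\<sigma>0 \<in> sums_of_squares. \<exists>\<sigma>1 \<in> sums_of_squares.
           f = \<sigma>0 + \<sigma>1 * (varX * (1 - varX)) \<and>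
           total_deg \<sigma>0 \<le> degX f + 3 \<and>
           total_deg (\<sigma>1 * (varX * (1 - varX))) \<le> degX f + 3"
proof -
  \<comment> \<open>Half of \<open>degX f\<close>, rounded up: the even exponent makes
    \<open>(1 - x) ^ (2 * m)\<close> a square. Rounding costs at most one of the three extra
    degrees; the other two come from the squared \<open>Y\<close> terms in \<open>s0\<close> and
    from the weight in \<open>s1\<close>.\<close>
  define m where "m = (degX f + 1) div 2"
  have m: "degX f \<le> 2 * m" "2 * m + 2 \<le> degX f + 3" by (auto simp: m_def)
  have degf: "degree (coeff f j) \<le> 2 * m" for j
  proof (rule degree_le, intro allI impI)
    fix i assume "2 * m < i"
    then show "coeff (coeff f j) i = 0"
      using degX_le_iff[of f "degX f"] m(1) by (meson le_refl le_trans not_le)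
  qed
  have f: "eval2 f x y = poly (coeff f 0) x + poly (coeff f 1) x * y + poly (coeff f 2) x * y\<^sup>2" for x y
  proof -
    have "eval2 f x y = (\<Sum>j\<le>2. poly (coeff f j) x * y ^ j)"
      unfolding eval2_sum_monomials using degY
      by (intro sum.mono_neutral_left) (auto simp: degY_def coeff_eq_0)
    then show ?thesis by (simp add: eval_nat_numeral)
  qed

  \<comment> \<open>The substitution \<open>x = t\<^sup>2 / (1 + t\<^sup>2)\<close> sends the real line to \<open>[0, 1)\<close>.\<close>
  define u v :: "real poly" where "u = [:0, 0, 1:]" and "v = [:1, 0, 1:]"
  have uv: "poly u t = t\<^sup>2" "poly v t = 1 + t\<^sup>2" for t
    by (simp_all add: u_def v_def power2_eq_square)
  have v_pos: "0 < 1 + t\<^sup>2" for t :: real by (simp add: add_pos_nonneg)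
  define F where "F j = homog (2 * m) (coeff f j) u v" for j
  have F: "poly (F j) t = (1 + t\<^sup>2) ^ (2 * m) * poly (coeff f j) (t\<^sup>2 / (1 + t\<^sup>2))" for j t
    using poly_homog[OF degf, of v t j u] v_pos[of t] by (simp add: F_def uv)
  have deg_F: "degree (F j) \<le> 4 * m" for j
    using degree_homog_le[of u 2 v "2 * m"] by (simp add: F_def u_def v_def)
  have Ff: "poly (F 0) t + poly (F 1) t * y + poly (F 2) t * y\<^sup>2
      = (1 + t\<^sup>2) ^ (2 * m) * eval2 f (t\<^sup>2 / (1 + t\<^sup>2)) y" for t y
    by (simp add: F f algebra_simps)
  have "0 \<le> poly (F 0) t + poly (F 1) t * y + poly (F 2) t * y\<^sup>2" for t y
    unfolding Ff by (intro mult_nonneg_nonneg nonneg) (use v_pos[of t] in \<open>auto simp: divide_simps\<close>)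
  then obtain p q :: "nat \<Rightarrow> real poly" where
    sos: "\<And>t y. poly (F 0) t + poly (F 1) t * y + poly (F 2) t * y\<^sup>2
        = (\<Sum>k<4. (poly (p k) t + poly (q k) t * y)\<^sup>2)"
    and p2: "\<And>t. poly (F 0) t = (\<Sum>k<4. (poly (p k) t)\<^sup>2)"
    and q2: "\<And>t. poly (F 2) t = (\<Sum>k<4. (poly (q k) t)\<^sup>2)"
    by (rule psd_quadratic_sum_of_squares) blast
  have deg_p: "degree (p k) \<le> 2 * m" and deg_q: "degree (q k) \<le> 2 * m" if "k < 4" for k
  proof -
    have "(poly (p k) t)\<^sup>2 \<le> poly (F 0) t" "(poly (q k) t)\<^sup>2 \<le> poly (F 2) t" for t
      unfolding p2 q2 using that by (auto intro!: member_le_sum)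
    then have "2 * degree (p k) \<le> degree (F 0)" "2 * degree (q k) \<le> degree (F 2)"
      by (intro degree_le_of_square_le; simp)+
    with deg_F[of 0] deg_F[of 2] show "degree (p k) \<le> 2 * m" "degree (q k) \<le> 2 * m" by linarith+
  qed

  have parts: "\<exists>e r. \<forall>k. (\<forall>t. poly (g k) t = poly (e k) (t\<^sup>2) + t * poly (r k) (t\<^sup>2)) \<and>
      2 * degree (e k) \<le> degree (g k) \<and> (r k = 0 \<or> 2 * degree (r k) + 1 \<le> degree (g k))"
    for g :: "nat \<Rightarrow> real poly"
    using allI[OF even_odd_parts, of g] unfolding choice_iff .
  obtain pe po where p: "\<And>k t. poly (p k) t = poly (pe k) (t\<^sup>2) + t * poly (po k) (t\<^sup>2)"
    and pe: "\<And>k. 2 * degree (pe k) \<le> degree (p k)"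
    and po: "\<And>k. po k = 0 \<or> 2 * degree (po k) + 1 \<le> degree (p k)"
    using parts[of p] by blast
  obtain qe qo where q: "\<And>k t. poly (q k) t = poly (qe k) (t\<^sup>2) + t * poly (qo k) (t\<^sup>2)"
    and qe: "\<And>k. 2 * degree (qe k) \<le> degree (q k)"
    and qo: "\<And>k. qo k = 0 \<or> 2 * degree (qo k) + 1 \<le> degree (q k)"
    using parts[of q] by blast

  \<comment> \<open>The inverse substitution: \<open>H n r\<close> is \<open>r\<close> at
    \<open>x / (1 - x)\<close>, with denominators cleared by \<open>(1 - x) ^ n\<close>.\<close>
  define H where "H n r = homog n r [:0, 1:] [:1, -1 :: real:]" for n r
  have H: "poly (H n r) x = (1 - x) ^ n * poly r (x / (1 - x))" if "degree r \<le> n" "x \<noteq> 1" for n r x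
    using poly_homog[of r n "[:1, -1:]" x "[:0, 1:]"] that by (simp add: H_def)
  have deg_H: "degree (H n r) \<le> n" for n r
    using degree_homog_le[of "[:0, 1:]" 1 "[:1, -1 :: real:]" n r] by (simp add: H_def)
  define E where "E k = [:H m (pe k), H m (qe k):]" for k
  \<comment> \<open>For \<open>k < 4\<close> the odd parts have degree at most \<open>m - 1\<close>;
    if \<open>m = 0\<close> they vanish, so the truncated subtraction does no harm.\<close>
  define R where "R k = [:H (m - 1) (po k), H (m - 1) (qo k):]" for k
  define s0 where "s0 = (\<Sum>k<4. (E k)\<^sup>2)"
  define s1 where "s1 = (\<Sum>k<4. (R k)\<^sup>2)"
  have s: "s0 \<in> sums_of_squares" "s1 \<in> sums_of_squares"
    unfolding s0_def s1_def sums_of_squares_def by blast+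

  have "total_deg (E k) \<le> m + 1" for k
    unfolding E_def by (intro total_deg_linear_le deg_H)
  then have "total_deg ((E k)\<^sup>2) \<le> (m + 1) + (m + 1)" for k
    unfolding power2_eq_square by (intro total_deg_mult_le)
  then have deg_s0: "total_deg s0 \<le> degX f + 3"
    unfolding s0_def using m(2) by (intro total_deg_sum_le) (metis add_2_eq_Suc' le_trans mult_2 add.assoc add.commute one_add_one)
  have R: "total_deg (R k) \<le> m" if "k < 4" for k
  proof (cases "m = 0")
    case True
    then have "po k = 0" "qo k = 0" using po[of k] qo[of k] deg_p[OF that] deg_q[OF that] by auto
    then show ?thesis by (simp add: R_def H_def total_deg_le_iff)
  next
    case False
    have "total_deg (R k) \<le> m - 1 + 1" unfolding R_def by (intro total_deg_linear_le deg_H)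
    then show ?thesis using False by simp
  qed
  have "total_deg s1 \<le> m + m"
    unfolding s1_def power2_eq_square by (intro total_deg_sum_le total_deg_mult_le R) auto
  moreover have "total_deg (varX * (1 - varX) :: real poly poly) \<le> 1 + 1"
    by (intro total_deg_mult_le)
      (auto simp: total_deg_le_iff varX_def one_pCons coeff_pCons split: nat.splits)
  ultimately have "total_deg (s1 * (varX * (1 - varX))) \<le> (m + m) + (1 + 1)"
    by (rule total_deg_mult_le)
  then have deg_s1: "total_deg (s1 * (varX * (1 - varX))) \<le> degX f + 3"
    using m(2) by linarith

  have "f = s0 + s1 * (varX * (1 - varX))"
  proof (rule eval2_eqI)
    show "infinite {0<..<1::real}" by simp
    fix x y :: real
    assume "x \<in> {0<..<1}"
    then have x: "0 < x" "x < 1" by auto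
    define t where "t = sqrt (x / (1 - x))"
    have t: "t\<^sup>2 = x / (1 - x)" using x by (simp add: t_def)
    have t1: "1 + t\<^sup>2 = 1 / (1 - x)" and tx: "t\<^sup>2 / (1 + t\<^sup>2) = x"
      using x by (simp_all add: t field_simps)
    define e where "e k = poly (pe k) (t\<^sup>2) + poly (qe k) (t\<^sup>2) * y" for k
    define r where "r k = poly (po k) (t\<^sup>2) + poly (qo k) (t\<^sup>2) * y" for k
    \<comment> \<open>Since \<open>x\<close> depends on \<open>t\<close> only through
      \<open>t\<^sup>2\<close>, the identity holds for \<open>t\<close> and \<open>- t\<close>;
      adding the two removes the cross terms \<open>2 * t * e k * r k\<close>.\<close>
    have sub: "eval2 f x y = (1 - x) ^ (2 * m) * (\<Sum>k<4. (e k + z * r k)\<^sup>2)" if "z\<^sup>2 = t\<^sup>2" for z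
    proof -
      have "(1 + z\<^sup>2) ^ (2 * m) * eval2 f (z\<^sup>2 / (1 + z\<^sup>2)) y = (\<Sum>k<4. (e k + z * r k)\<^sup>2)"
        unfolding Ff[symmetric] sos by (intro sum.cong) (simp_all add: p q e_def r_def that algebra_simps)
      then have "(1 + t\<^sup>2) ^ (2 * m) * eval2 f x y = (\<Sum>k<4. (e k + z * r k)\<^sup>2)"
        by (simp only: that tx)
      then show ?thesis using x by (simp add: t1 field_simps)
    qed
    have "2 * eval2 f x y = (1 - x) ^ (2 * m) * (\<Sum>k<4. (e k + t * r k)\<^sup>2)
        + (1 - x) ^ (2 * m) * (\<Sum>k<4. (e k + - t * r k)\<^sup>2)"
      using sub[of t] sub[of "- t"] by simp
    also have "\<dots> = (1 - x) ^ (2 * m) * (\<Sum>k<4. 2 * ((e k)\<^sup>2 + t\<^sup>2 * (r k)\<^sup>2))"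
      unfolding distrib_left[symmetric] sum.distrib[symmetric]
      by (intro arg_cong2[of _ _ _ _ "(*)"] sum.cong refl) (simp add: power2_eq_square algebra_simps)
    finally have f': "eval2 f x y = (\<Sum>k<4. (1 - x) ^ (2 * m) * ((e k)\<^sup>2 + t\<^sup>2 * (r k)\<^sup>2))"
      unfolding sum_distrib_left[symmetric] by simp
    also have "\<dots> = (\<Sum>k<4. (eval2 (E k) x y)\<^sup>2 + (eval2 (R k) x y)\<^sup>2 * (x * (1 - x)))"
    proof (intro sum.cong refl)
      fix k :: nat assume "k \<in> {..<4}"
      then have k: "k < 4" by simp
      have "eval2 (E k) x y = (1 - x) ^ m * e k"
        using pe[of k] qe[of k] deg_p[OF k] deg_q[OF k] x
        by (simp add: E_def eval2_linear H t e_def algebra_simps)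
      moreover have "(1 - x) ^ (2 * m) * (t\<^sup>2 * (r k)\<^sup>2) = (eval2 (R k) x y)\<^sup>2 * (x * (1 - x))"
      proof (cases "m = 0")
        case True
        then have "po k = 0" "qo k = 0" using po[of k] qo[of k] deg_p[OF k] deg_q[OF k] by auto
        then show ?thesis by (simp add: r_def R_def H_def eval2_def)
      next
        case False
        then obtain l where l: "m = Suc l" using not0_implies_Suc by blast
        have "degree (po k) \<le> l" "degree (qo k) \<le> l"
          using po[of k] qo[of k] deg_p[OF k] deg_q[OF k] l by auto
        then have "eval2 (R k) x y = (1 - x) ^ l * r k"
          using x by (simp add: R_def eval2_linear H t r_def l algebra_simps)
        \<comment> \<open>One factor \<open>1 - x\<close> turns \<open>t\<^sup>2\<close> into
          \<open>x\<close> and a second one remains: this is the source of the weight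
          \<open>x * (1 - x)\<close> and of the exponent \<open>m - 1\<close> in
          \<open>R\<close>.\<close>
        moreover have "(1 - x) ^ (2 * m) * t\<^sup>2 = ((1 - x) ^ l)\<^sup>2 * (x * (1 - x))"
        proof -
          have "(1 - x) ^ (2 * m) * t\<^sup>2 = ((1 - x) ^ l)\<^sup>2 * (((1 - x) * t\<^sup>2) * (1 - x))"
            by (simp add: l power_even_eq power2_eq_square)
          moreover have "(1 - x) * t\<^sup>2 = x" using x by (simp add: t)
          ultimately show ?thesis by simp
        qed
        ultimately show ?thesis by (simp add: power_mult_distrib mult_ac)
      qed
      ultimately show "(1 - x) ^ (2 * m) * ((e k)\<^sup>2 + t\<^sup>2 * (r k)\<^sup>2)
          = (eval2 (E k) x y)\<^sup>2 + (eval2 (R k) x y)\<^sup>2 * (x * (1 - x))"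
        by (simp add: distrib_left power_mult_distrib power_mult[symmetric] mult.commute)
    qed
    also have "\<dots> = eval2 (s0 + s1 * (varX * (1 - varX))) x y"
    proof -
      have "eval2 (1 - varX) x y = 1 - x" by (simp add: eval2_def varX_def)
      then show ?thesis
        by (simp add: s0_def s1_def eval2_add eval2_mult eval2_sum eval2_power sum.distrib sum_distrib_right)
    qed
    finally show "eval2 f x y = eval2 (s0 + s1 * (varX * (1 - varX))) x y" .
  qed
  with s deg_s0 deg_s1 show ?thesis by blast
qed

end
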